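(* The class of static games is closed under $\mathrm{Rec}^{\aleph_0}_L$ and $\mathrm{Corec}^{\aleph_0}_L$.
   Context: Games are pairs $A=(\mathbf{Lr}^A,\mathbf{Wn}^A)$ between the machine $\top$ and the environment $\bot$, as in Japaridze's computability logic; a game is static if postponing one's own moves (passing to a $\wp$-delay of a run) never turns a $\wp$-legal (resp. $\wp$-won) run into a $\wp$-illegal (resp. non-$\wp$-won) one. For a run $\Gamma$ and an infinite bitstring $x$, $\Gamma^{\preceq x}$ is the result of keeping only the moves of the form $u.\beta$ with $u$ a finite initial segment of $x$ and deleting the prefix $u.$ from them. A bitstring is essentially finite if it contains only finitely many 1s. The countable branching recurrence (new version) $\mathrm{Rec}^{\aleph_0}_L A$ is defined by: $\Gamma$ is a legal run iff every move of $\Gamma$ is $w.\alpha$ for a finite bitstring $w$ and move $\alpha$ and, for every infinite bitstring $x$, $\Gamma^{\preceq x}\in\mathbf{Lr}^A$; a legal run $\Omega$ is won by $\top$ iff for every infinite but essentially finite bitstring $v$, $\mathbf{Wn}^A\langle\Omega^{\preceq v}\rangle=\top$. The countable branching corecurrence $\mathrm{Corec}^{\aleph_0}_L A$ has the same legal runs, and $\top$ wins a legal run iff $\mathbf{Wn}^A\langle\Omega^{\preceq v}\rangle=\top$ for some infinite but essentially finite $v$; equivalently $\mathrm{Corec}^{\aleph_0}_L A=\neg\mathrm{Rec}^{\aleph_0}_L\neg A$. *)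

theory Defs
  imports Main "HOL-Library.Sublist" "HOL-Library.Infinite_Set"
begin

datatype 'a seq = Fin "'a list" | Inf "nat \<Rightarrow> 'a"

fun initial_segment :: "'a list \<Rightarrow> 'a seq \<Rightarrow> bool" where
  "initial_segment xs (Fin ys) \<longleftrightarrow> prefix xs ys"
| "initial_segment xs (Inf f) \<longleftrightarrow> xs = map f [0..<length xs]"

text \<open>Filtering an infinite sequence may leave a finite one.\<close>

fun filter_seq :: "('a \<Rightarrow> bool) \<Rightarrow> 'a seq \<Rightarrow> 'a seq" where
  "filter_seq P (Fin xs) = Fin (filter P xs)"
| "filter_seq P (Inf f) =
     (let I = {i. P (f i)}
      in if finite I then Fin (map f (sorted_list_of_set I))
         else Inf (\<lambda>n. f (Infinite_Set.enumerate I n)))"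

text \<open>Position \<open>i\<close> carries the entry number \<open>n\<close> (counting from 0) among those satisfying \<open>P\<close>.\<close>

definition occurrence_at :: "('a \<Rightarrow> bool) \<Rightarrow> 'a seq \<Rightarrow> nat \<Rightarrow> nat \<Rightarrow> bool" where
  "occurrence_at P s n i \<longleftrightarrow>
     (\<exists>xs a. length xs = i \<and> initial_segment (xs @ [a]) s \<and> P a \<and> length (filter P xs) = n)"

datatype player = Machine | Environment

fun opponent :: "player \<Rightarrow> player" where
  "opponent Machine = Environment"
| "opponent Environment = Machine"

type_synonym move = string
type_synonym labmove = "player \<times> move"
type_synonym run = "labmove seq"

abbreviation by_player :: "player \<Rightarrow> labmove \<Rightarrow> bool" where
  "by_player p m \<equiv> fst m = p"

record game =
  Lr :: "run set"
  Wn :: "run \<Rightarrow> player"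

definition illegal_for :: "player \<Rightarrow> run set \<Rightarrow> run \<Rightarrow> bool" where
  "illegal_for p L \<Gamma> \<longleftrightarrow>
     (\<exists>xs \<alpha>. initial_segment (xs @ [(p, \<alpha>)]) \<Gamma> \<and> Fin (xs @ [(p, \<alpha>)]) \<notin> L \<and>
             (\<forall>ys. prefix ys xs \<longrightarrow> Fin ys \<in> L))"

definition legal_for :: "player \<Rightarrow> run set \<Rightarrow> run \<Rightarrow> bool" where
  "legal_for p L \<Gamma> \<longleftrightarrow> \<not> illegal_for p L \<Gamma>"

text \<open>The first condition forces the empty run to be legal.\<close>

definition is_game :: "game \<Rightarrow> bool" where
  "is_game A \<longleftrightarrow>
     (\<forall>\<Gamma>. \<Gamma> \<in> Lr A \<longleftrightarrow> (\<forall>xs. xs \<noteq> [] \<longrightarrow> initial_segment xs \<Gamma> \<longrightarrow> Fin xs \<in> Lr A)) \<and>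
     (\<forall>\<Gamma> p. illegal_for p (Lr A) \<Gamma> \<longrightarrow> Wn A \<Gamma> = opponent p)"

definition later :: "player \<Rightarrow> run \<Rightarrow> nat \<Rightarrow> nat \<Rightarrow> bool" where
  "later p \<Gamma> n k \<longleftrightarrow>
     (\<exists>i j. occurrence_at (by_player p) \<Gamma> n i \<and>
            occurrence_at (by_player (opponent p)) \<Gamma> k j \<and> j < i)"

text \<open>\<open>delay p \<Upsilon> \<Gamma>\<close>: the run \<open>\<Upsilon>\<close> is a \<open>p\<close>-delay of the run \<open>\<Gamma>\<close>.\<close>

definition delay :: "player \<Rightarrow> run \<Rightarrow> run \<Rightarrow> bool" where
  "delay p \<Upsilon> \<Gamma> \<longleftrightarrow>
     (\<forall>q. filter_seq (by_player q) \<Upsilon> = filter_seq (by_player q) \<Gamma>) \<and>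
     (\<forall>n k. later p \<Gamma> n k \<longrightarrow> later p \<Upsilon> n k)"

definition static :: "game \<Rightarrow> bool" where
  "static A \<longleftrightarrow>
     (\<forall>p \<Gamma> \<Upsilon>. delay p \<Upsilon> \<Gamma> \<longrightarrow>
        (legal_for p (Lr A) \<Gamma> \<longrightarrow> legal_for p (Lr A) \<Upsilon>) \<and>
        (Wn A \<Gamma> = p \<longrightarrow> Wn A \<Upsilon> = p))"

definition static_game :: "game \<Rightarrow> bool" where
  "static_game A \<longleftrightarrow> is_game A \<and> static A"

text \<open>Bits are Booleans, \<open>True\<close> being 1; \<open>prefixed w \<alpha>\<close> is the move \<open>w.\<alpha>\<close>.\<close>

definition bit_char :: "bool \<Rightarrow> char" where
  "bit_char b = (if b then CHR ''1'' else CHR ''0'')"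

definition prefixed :: "bool list \<Rightarrow> move \<Rightarrow> move" where
  "prefixed w \<alpha> = map bit_char w @ CHR ''.'' # \<alpha>"

definition on_branch :: "(nat \<Rightarrow> bool) \<Rightarrow> move \<Rightarrow> bool" where
  "on_branch x m \<longleftrightarrow> (\<exists>u \<beta>. initial_segment u (Inf x) \<and> m = prefixed u \<beta>)"

definition strip :: "move \<Rightarrow> move" where
  "strip m = tl (dropWhile (\<lambda>c. c \<noteq> CHR ''.'') m)"

lemma strip_prefixed [simp]: "strip (prefixed u \<beta>) = \<beta>"
  by (induction u) (auto simp: strip_def prefixed_def bit_char_def)

definition branch :: "run \<Rightarrow> (nat \<Rightarrow> bool) \<Rightarrow> run" where
  "branch \<Gamma> x = map_seq (map_prod id strip) (filter_seq (on_branch x \<circ> snd) \<Gamma>)"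

definition essentially_finite :: "(nat \<Rightarrow> bool) \<Rightarrow> bool" where
  "essentially_finite x \<longleftrightarrow> finite {i. x i}"

definition rec_Lr :: "game \<Rightarrow> run set" where
  "rec_Lr A = {\<Gamma>. (\<forall>m \<in> set_seq \<Gamma>. \<exists>w \<alpha>. snd m = prefixed w \<alpha>) \<and> (\<forall>x. branch \<Gamma> x \<in> Lr A)}"

text \<open>
  An illegal run is lost by the player whose move ends its shortest illegal initial segment, so a
  game is determined by its legal runs \<open>L\<close> and the condition \<open>W\<close> for the machine to win a legal run.
\<close>

definition make_game :: "run set \<Rightarrow> (run \<Rightarrow> bool) \<Rightarrow> game" where
  "make_game L W =
     \<lparr>Lr = L,
      Wn = (\<lambda>\<Gamma>. if \<Gamma> \<in> L then (if W \<Gamma> then Machine else Environment)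
                else if illegal_for Machine L \<Gamma> then Environment else Machine)\<rparr>"

definition Rec :: "game \<Rightarrow> game" where
  "Rec A = make_game (rec_Lr A)
     (\<lambda>\<Omega>. \<forall>v. essentially_finite v \<longrightarrow> Wn A (branch \<Omega> v) = Machine)"

definition Corec :: "game \<Rightarrow> game" where
  "Corec A = make_game (rec_Lr A)
     (\<lambda>\<Omega>. \<exists>v. essentially_finite v \<and> Wn A (branch \<Omega> v) = Machine)"

end

theory Submission imports Defs begin

text \<open>
  That one run is a delay of another can be read off finite initial segments, in a form that is
  symmetric under swapping the two runs together with the two players and that passes to all
  branches. Given this, the winning part is staticity of the original game on each branch. For
  legality, if the first illegal move of a run is made by the opponent of \<open>p\<close>, then every
  \<open>p\<close>-delay of that run is illegal by the time of the corresponding move, and likewise with the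
  roles swapped. If \<open>p\<close> were the first to move illegally in a \<open>p\<close>-delay of a run but not in the
  run itself, then in the run the offending move of the opponent would precede the counterpart of
  that of \<open>p\<close>; the delay preserves this order, so the opponent's move would come first there too.
\<close>

section \<open>Sequences and their initial segments\<close>

lemma initial_segment_Nil [simp]: "initial_segment [] s"
  by (cases s) auto

lemma initial_segment_Inf_iff: "initial_segment xs (Inf f) \<longleftrightarrow> (\<exists>n. xs = map f [0..<n])"
  by auto

lemma prefix_map_upt:
  assumes "m \<le> n"
  shows "prefix (map f [0..<m]) (map f [0..<n])"
  using upt_add_eq_append[of 0 m "n - m"] assms by auto

lemma prefix_map_uptD: "prefix xs (map f [0..<n]) \<Longrightarrow> \<exists>m. xs = map f [0..<m]"
proof -
  assume xs: "prefix xs (map f [0..<n])"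
  then have "length xs \<le> n" using prefix_length_le by fastforce
  then have "take (length xs) (map f [0..<n]) = map f [0..<length xs]" by (simp add: take_map)
  moreover have "xs = take (length xs) (map f [0..<n])"
    using xs by (auto simp: prefix_def append_eq_conv_conj)
  ultimately show ?thesis by metis
qed

lemma initial_segment_prefix:
  assumes "initial_segment xs s" "prefix ys xs"
  shows "initial_segment ys s"
  using assms prefix_map_uptD
  by (cases s) (auto simp del: initial_segment.simps(2) simp: initial_segment_Inf_iff)

lemma initial_segment_appendD: "initial_segment (xs @ ys) s \<Longrightarrow> initial_segment xs s"
  by (erule initial_segment_prefix) simp

lemma initial_segment_comparable:
  assumes "initial_segment xs s" "initial_segment ys s"
  shows "prefix xs ys \<or> prefix ys xs"
proof (cases s)
  case (Fin zs)
  then show ?thesis using assms prefix_same_cases by auto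
next
  case (Inf f)
  then show ?thesis
    using assms prefix_map_upt nat_le_linear unfolding Inf initial_segment_Inf_iff by metis
qed

lemma initial_segment_length_le_prefix:
  assumes "initial_segment xs s" "initial_segment ys s" "length xs \<le> length ys"
  shows "prefix xs ys"
  using initial_segment_comparable[OF assms(1,2)] assms(3) by (auto simp: prefix_def)

text \<open>An infinite sequence has longer initial segments than any given finite one; two
  sequences of the same kind are compared at full length or entry by entry.\<close>

lemma seq_eqI:
  assumes "\<And>xs. initial_segment xs s \<longleftrightarrow> initial_segment xs t"
  shows "s = t"
proof -
  have mixed: False if "\<And>xs. initial_segment xs (Fin ys) \<longleftrightarrow> initial_segment xs (Inf f)"
    for ys :: "'a list" and f
    using that[of "map f [0..<Suc (length ys)]"] by (auto dest: prefix_length_le)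
  show ?thesis
  proof (cases s; cases t)
    fix ys zs assume "s = Fin ys" "t = Fin zs"
    then show ?thesis using assms[of ys] assms[of zs] by (auto intro: prefix_order.antisym)
  next
    fix f g assume st: "s = Inf f" "t = Inf g"
    have "f n = g n" for n
      using assms[of "map f [0..<Suc n]"] by (simp add: st)
    then show ?thesis by (auto simp: st)
  qed (use assms mixed in metis)+
qed

lemma prefix_filter_iff:
  "prefix xs (filter P ys) \<longleftrightarrow> (\<exists>zs. prefix zs ys \<and> xs = filter P zs)"
proof
  show "prefix xs (filter P ys) \<Longrightarrow> \<exists>zs. prefix zs ys \<and> xs = filter P zs"
  proof (induction ys arbitrary: xs)
    case (Cons a ys)
    show ?case
    proof (cases "P a")
      case False
      then obtain zs where "prefix zs ys" "xs = filter P zs" using Cons by auto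
      then show ?thesis using False by (intro exI[of _ "a # zs"]) auto
    next
      case True
      show ?thesis
      proof (cases xs)
        case Nil
        then show ?thesis by (intro exI[of _ "[]"]) auto
      next
        case (Cons b xs')
        then have "prefix xs' (filter P ys)" "a = b" using Cons.prems True by auto
        then obtain zs where "prefix zs ys" "xs' = filter P zs" using Cons.IH by blast
        then show ?thesis
          using True \<open>a = b\<close> \<open>xs = b # xs'\<close> by (intro exI[of _ "a # zs"]) auto
      qed
    qed
  qed auto
qed (auto intro: filter_mono_prefix)

text \<open>Both sides list the elements of \<open>I\<close> below \<open>enumerate I m\<close> in
  increasing order without repetition.\<close>

lemma filter_upt_enumerate:
  fixes I :: "nat set"
  assumes "infinite I"
  shows "filter (\<lambda>i. i \<in> I) [0..<enumerate I m] = map (enumerate I) [0..<m]"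
proof (rule sorted_distinct_set_unique)
  show "sorted (map (enumerate I) [0..<m])"
    using assms by (auto simp: sorted_iff_nth_mono)
  show "distinct (map (enumerate I) [0..<m])"
    using inj_enumerate[OF assms] by (auto simp: distinct_map intro: inj_on_subset)
  show "set (filter (\<lambda>i. i \<in> I) [0..<enumerate I m]) = set (map (enumerate I) [0..<m])"
  proof -
    have "i \<in> enumerate I ` {0..<m}" if "i \<in> I" "i < enumerate I m" for i
      using enumerate_Ex[OF assms that(1)] that(2) assms by auto
    then show ?thesis using assms by (auto simp: enumerate_in_set)
  qed
qed (auto simp: sorted_wrt_filter)

text \<open>This removes the case distinction in \<open>filter_seq\<close>: later arguments treat
  finite and infinite runs alike, through finite initial segments.\<close>

lemma initial_segment_filter_seq:
  "initial_segment xs (filter_seq P s) \<longleftrightarrow> (\<exists>ys. initial_segment ys s \<and> xs = filter P ys)"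
proof (cases s)
  case (Fin zs)
  then show ?thesis by (simp add: prefix_filter_iff)
next
  case s: (Inf f)
  define I where "I = {i. P (f i)}"
  have filter_I: "filter P (map f [0..<n]) = map f (filter (\<lambda>i. i \<in> I) [0..<n])" for n
    by (simp add: filter_map I_def comp_def)
  show ?thesis
  proof (cases "finite I")
    case True
    then obtain N where N: "\<And>i. i \<in> I \<Longrightarrow> i < N"
      by (meson finite_nat_set_iff_bounded)
    \<comment> \<open>From \<open>N\<close> on nothing passes the filter, so every sufficiently long
      initial segment already yields the whole filtered sequence.\<close>
    have "filter (\<lambda>i. i \<in> I) [0..<n] = sorted_list_of_set I" if "N \<le> n" for n
      using True N that
      by (intro sorted_distinct_set_unique) (force simp: sorted_wrt_filter)+
    then have fs: "filter_seq P s = Fin (filter P (map f [0..<n]))" if "N \<le> n" for n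
      using True that unfolding filter_I by (simp add: s I_def[symmetric])
    show ?thesis
    proof
      assume "initial_segment xs (filter_seq P s)"
      then have "prefix xs (filter P (map f [0..<N]))" unfolding fs[OF order_refl] by simp
      then obtain ys where "prefix ys (map f [0..<N])" "xs = filter P ys"
        by (auto simp: prefix_filter_iff)
      then show "\<exists>ys. initial_segment ys s \<and> xs = filter P ys"
        unfolding s initial_segment_Inf_iff by (blast dest: prefix_map_uptD)
    next
      assume "\<exists>ys. initial_segment ys s \<and> xs = filter P ys"
      then obtain n where "xs = filter P (map f [0..<n])"
        unfolding s initial_segment_Inf_iff by blast
      then show "initial_segment xs (filter_seq P s)"
        by (auto simp: fs[of "max n N"] intro!: filter_mono_prefix prefix_map_upt)
    qed
  next
    case False
    then have fs: "filter_seq P s = Inf (f \<circ> enumerate I)"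
      by (simp add: s I_def[symmetric] comp_def)
    have seg: "map (f \<circ> enumerate I) [0..<m] = filter P (map f [0..<enumerate I m])" for m
      unfolding filter_I filter_upt_enumerate[OF False] by simp
    show ?thesis
    proof
      assume "initial_segment xs (filter_seq P s)"
      then obtain m where "xs = map (f \<circ> enumerate I) [0..<m]"
        unfolding fs initial_segment_Inf_iff by blast
      then show "\<exists>ys. initial_segment ys s \<and> xs = filter P ys"
        unfolding s initial_segment_Inf_iff seg by metis
    next
      assume "\<exists>ys. initial_segment ys s \<and> xs = filter P ys"
      then obtain n where "xs = filter P (map f [0..<n])"
        unfolding s initial_segment_Inf_iff by blast
      \<comment> \<open>Since \<open>n \<le> enumerate I n\<close>, the first \<open>n\<close>
        filtered entries cover whatever survives of the first \<open>n\<close> entries of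
        \<open>f\<close>.\<close>
      then have "prefix xs (map (f \<circ> enumerate I) [0..<n])"
        unfolding seg using le_enumerate[OF False]
        by (auto intro!: filter_mono_prefix prefix_map_upt)
      then show "initial_segment xs (filter_seq P s)"
        unfolding fs initial_segment_Inf_iff by (rule prefix_map_uptD)
    qed
  qed
qed

lemma initial_segment_map_seq:
  "initial_segment xs (map_seq f s) \<longleftrightarrow> (\<exists>ys. initial_segment ys s \<and> xs = map f ys)"
proof (cases s)
  case (Fin zs)
  then show ?thesis by (auto dest: prefix_map_rightE intro: map_mono_prefix)
next
  case (Inf g)
  then show ?thesis
    unfolding Inf seq.map(2) initial_segment_Inf_iff by (metis map_map)
qed

lemma set_seq_iff_initial_segment: "a \<in> set_seq s \<longleftrightarrow> (\<exists>xs. initial_segment xs s \<and> a \<in> set xs)"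
proof (cases s)
  case (Fin zs)
  then show ?thesis by (auto dest: set_mono_prefix)
next
  case (Inf f)
  have "f i \<in> set (map f [0..<Suc i])" for i by simp
  then have "f i \<in> set_seq s \<and> (\<exists>xs. initial_segment xs s \<and> f i \<in> set xs)" for i
    unfolding Inf initial_segment_Inf_iff by (metis rangeI seq.set(2))
  then show ?thesis
    unfolding Inf initial_segment_Inf_iff by auto
qed

section \<open>Sets of legal runs\<close>

text \<open>The first condition of \<open>is_game\<close>, stated for a set of runs so that it can
  be established for \<open>rec_Lr A\<close> on its own.\<close>

definition legal_run_set :: "run set \<Rightarrow> bool" where
  "legal_run_set L \<longleftrightarrow>
     (\<forall>\<Gamma>. \<Gamma> \<in> L \<longleftrightarrow> (\<forall>xs. xs \<noteq> [] \<longrightarrow> initial_segment xs \<Gamma> \<longrightarrow> Fin xs \<in> L))"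

lemma legal_run_set_Nil: "legal_run_set L \<Longrightarrow> Fin [] \<in> L"
  unfolding legal_run_set_def by (metis initial_segment.simps(1) prefix_bot.bot_unique)

lemma legal_run_set_iff:
  assumes "legal_run_set L"
  shows "\<Gamma> \<in> L \<longleftrightarrow> (\<forall>xs. initial_segment xs \<Gamma> \<longrightarrow> Fin xs \<in> L)"
  using assms legal_run_set_Nil[OF assms] unfolding legal_run_set_def by metis

lemma legal_run_set_prefix:
  assumes "legal_run_set L" "Fin xs \<in> L" "prefix ys xs"
  shows "Fin ys \<in> L"
  using assms legal_run_set_iff[OF assms(1), of "Fin xs"] by auto

text \<open>Closure under prefixes reduces the condition on all shorter segments to the one on
  \<open>xs\<close>.\<close>

lemma illegal_for_iff:
  assumes "legal_run_set L"
  shows "illegal_for p L \<Gamma> \<longleftrightarrow>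
    (\<exists>xs \<alpha>. initial_segment (xs @ [(p, \<alpha>)]) \<Gamma> \<and> Fin (xs @ [(p, \<alpha>)]) \<notin> L \<and> Fin xs \<in> L)"
  unfolding illegal_for_def using legal_run_set_prefix[OF assms] by blast

lemma illegal_for_notin: "legal_run_set L \<Longrightarrow> illegal_for p L \<Gamma> \<Longrightarrow> \<Gamma> \<notin> L"
  by (auto simp: illegal_for_iff legal_run_set_iff[of L \<Gamma>])

text \<open>Shortening an illegal segment move by move reaches a legal one, at the latest the empty
  run; the last move removed reveals the offender.\<close>

lemma illegal_for_exists:
  assumes "legal_run_set L" "\<Gamma> \<notin> L"
  obtains p where "illegal_for p L \<Gamma>"
proof -
  have "\<exists>p xs \<alpha>. initial_segment (xs @ [(p, \<alpha>)]) \<Gamma> \<and> Fin (xs @ [(p, \<alpha>)]) \<notin> L \<and> Fin xs \<in> L"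
    if "initial_segment ys \<Gamma>" "Fin ys \<notin> L" for ys
    using that
  proof (induction ys rule: rev_induct)
    case Nil
    then show ?case using legal_run_set_Nil[OF assms(1)] by simp
  next
    case (snoc m ys)
    then show ?case
      by (cases m; cases "Fin ys \<in> L") (blast dest: initial_segment_appendD)+
  qed
  then show ?thesis
    using assms that by (metis illegal_for_iff legal_run_set_iff)
qed

text \<open>Two minimal illegal segments of one run are comparable, hence equal, and so are their
  last moves.\<close>

lemma illegal_for_unique:
  assumes L: "legal_run_set L" and "illegal_for p L \<Gamma>" "illegal_for q L \<Gamma>"
  shows "p = q"
proof -
  obtain xs \<alpha> where xs: "initial_segment (xs @ [(p, \<alpha>)]) \<Gamma>" "Fin (xs @ [(p, \<alpha>)]) \<notin> L" "Fin xs \<in> L"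
    using assms by (auto simp: illegal_for_iff)
  obtain ys \<beta> where ys: "initial_segment (ys @ [(q, \<beta>)]) \<Gamma>" "Fin (ys @ [(q, \<beta>)]) \<notin> L" "Fin ys \<in> L"
    using assms by (auto simp: illegal_for_iff)
  have "\<not> prefix (xs @ [(p, \<alpha>)]) ys" "\<not> prefix (ys @ [(q, \<beta>)]) xs"
    using legal_run_set_prefix[OF L] xs ys by blast+
  then show ?thesis
    using initial_segment_comparable[OF xs(1) ys(1)] by auto
qed

section \<open>Delays and branches\<close>

lemma opponent_neq [simp]: "opponent p \<noteq> p" "p \<noteq> opponent p"
  by (cases p; simp)+

lemma opponent_opponent [simp]: "opponent (opponent p) = p"
  by (cases p) auto

lemma player_neq_iff: "q \<noteq> p \<longleftrightarrow> q = opponent p"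
  by (cases p; cases q) auto

lemma split_at_occurrence:
  "n < length (filter P xs) \<Longrightarrow> \<exists>ys a. prefix (ys @ [a]) xs \<and> P a \<and> length (filter P ys) = n"
proof (induction xs rule: rev_induct)
  case (snoc x xs)
  show ?case
  proof (cases "n < length (filter P xs)")
    case True
    then show ?thesis using snoc.IH by (meson prefix_prefix)
  next
    case False
    then show ?thesis
      using snoc.prems by (intro exI[of _ xs] exI[of _ x]) (auto split: if_splits)
  qed
qed simp

text \<open>The number of entries satisfying \<open>P\<close> is monotone along the initial segments
  of \<open>s\<close>, so it locates a segment relative to a given occurrence.\<close>

lemma prefix_occurrence:
  assumes "initial_segment (xs @ [a]) s" "P a" "initial_segment ys s"
  shows "length (filter P xs) < length (filter P ys) \<Longrightarrow> prefix (xs @ [a]) ys"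
    and "length (filter P ys) \<le> length (filter P xs) \<Longrightarrow> prefix ys xs"
proof -
  have mono: "length (filter P us) \<le> length (filter P vs)" if "prefix us vs" for us vs
    using that by (intro prefix_length_le filter_mono_prefix)
  show "length (filter P xs) < length (filter P ys) \<Longrightarrow> prefix (xs @ [a]) ys"
    using initial_segment_comparable[OF assms(1,3)] mono[of ys xs] by auto
  show "length (filter P ys) \<le> length (filter P xs) \<Longrightarrow> prefix ys xs"
    using initial_segment_comparable[OF assms(1,3)] mono[of "xs @ [a]" ys] \<open>P a\<close> by auto
qed

lemma filter_seq_eq_initial_segment:
  assumes "filter_seq P s = filter_seq P t" "initial_segment xs s"
  obtains ys where "initial_segment ys t" "filter P ys = filter P xs"
  using assms by (metis initial_segment_filter_seq)

abbreviation num_moves :: "player \<Rightarrow> labmove list \<Rightarrow> nat" where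
  "num_moves p xs \<equiv> length (filter (by_player p) xs)"

lemma num_moves_prefix: "prefix xs ys \<Longrightarrow> num_moves p xs \<le> num_moves p ys"
  by (intro prefix_length_le filter_mono_prefix)

text \<open>This form of the delay condition refers only to finite initial segments and is symmetric under
  swapping the two runs together with the two players.\<close>

lemma delay_iff:
  "delay p \<Upsilon> \<Gamma> \<longleftrightarrow>
     (\<forall>q. filter_seq (by_player q) \<Upsilon> = filter_seq (by_player q) \<Gamma>) \<and>
     (\<forall>u g. initial_segment u \<Upsilon> \<longrightarrow> initial_segment g \<Gamma> \<longrightarrow>
        \<not> (num_moves p g < num_moves p u \<and> num_moves (opponent p) u < num_moves (opponent p) g))"
    (is "_ \<longleftrightarrow> ?same \<and> ?lag")
proof
  assume d: "delay p \<Upsilon> \<Gamma>"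
  then have same: ?same by (simp add: delay_def)
  have False if u: "initial_segment u \<Upsilon>" and g: "initial_segment g \<Gamma>"
    and p: "num_moves p g < num_moves p u"
    and o: "num_moves (opponent p) u < num_moves (opponent p) g" for u g
  proof -
    \<comment> \<open>Counting from 0, \<open>?n\<close> is the first move of \<open>p\<close> that
      \<open>u\<close> contains and \<open>g\<close> lacks, \<open>?k\<close> the first move of the
      opponent that \<open>g\<close> contains and \<open>u\<close> lacks. In \<Gamma> the former
      comes later; the same order in \<Upsilon> would put move \<open>?k\<close> inside
      \<open>u\<close>.\<close>
    let ?n = "num_moves p g" and ?k = "num_moves (opponent p) u"
    obtain g' where g': "initial_segment g' \<Gamma>" "filter (by_player p) g' = filter (by_player p) u"
      using same u by (metis filter_seq_eq_initial_segment)
    obtain ys a where ys: "prefix (ys @ [a]) g'" "by_player p a" "num_moves p ys = ?n"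
      using split_at_occurrence[of ?n "by_player p" g'] p g' by auto
    have ys': "initial_segment (ys @ [a]) \<Gamma>"
      using ys g' initial_segment_prefix by blast
    have "prefix g ys"
      using prefix_occurrence(2)[OF ys', where P="by_player p"] ys g by simp
    obtain zs b where zs: "prefix (zs @ [b]) g" "by_player (opponent p) b"
      "num_moves (opponent p) zs = ?k"
      using split_at_occurrence[OF o] by blast
    have "initial_segment (zs @ [b]) \<Gamma>"
      using zs g initial_segment_prefix by blast
    moreover have "length zs < length ys"
      using prefix_length_le[OF zs(1)] prefix_length_le[OF \<open>prefix g ys\<close>] by simp
    ultimately have "later p \<Gamma> ?n ?k"
      unfolding later_def occurrence_at_def using ys ys' zs by blast
    then have "later p \<Upsilon> ?n ?k" using d by (simp add: delay_def)
    then obtain us a vs b where us: "initial_segment (us @ [a]) \<Upsilon>" "by_player p a"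
      "num_moves p us = ?n" and vs: "initial_segment (vs @ [b]) \<Upsilon>" "by_player (opponent p) b"
      "num_moves (opponent p) vs = ?k" and less: "length vs < length us"
      unfolding later_def occurrence_at_def by blast
    have "prefix (us @ [a]) u"
      using prefix_occurrence(1)[OF us(1), where P="by_player p"] us u p by simp
    moreover have "prefix (vs @ [b]) (us @ [a])"
      using initial_segment_length_le_prefix[OF vs(1) us(1)] less by simp
    ultimately have "prefix (vs @ [b]) u" by (rule prefix_order.trans[rotated])
    then have "num_moves (opponent p) (vs @ [b]) \<le> ?k" by (rule num_moves_prefix)
    then show False using vs by simp
  qed
  then show "?same \<and> ?lag" using same by blast
next
  assume r: "?same \<and> ?lag"
  have "later p \<Upsilon> n k" if later: "later p \<Gamma> n k" for n k
  proof -
    obtain ys a zs b where ys: "initial_segment (ys @ [a]) \<Gamma>" "by_player p a"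
      "num_moves p ys = n" and zs: "initial_segment (zs @ [b]) \<Gamma>" "by_player (opponent p) b"
      "num_moves (opponent p) zs = k" and less: "length zs < length ys"
      using later unfolding later_def occurrence_at_def by blast
    obtain u where u: "initial_segment u \<Upsilon>"
      "filter (by_player p) u = filter (by_player p) (ys @ [a])"
      using r ys by (metis filter_seq_eq_initial_segment)
    obtain us c where us: "prefix (us @ [c]) u" "by_player p c" "num_moves p us = n"
      using split_at_occurrence[of n "by_player p" u] u ys by auto
    have us': "initial_segment (us @ [c]) \<Upsilon>" using us u initial_segment_prefix by blast
    have ys': "initial_segment ys \<Gamma>" using ys initial_segment_appendD by blast
    \<comment> \<open>The inequality condition is applied to the segment of \<Gamma> ending just
      before move \<open>n\<close> of \<open>p\<close> and the segment of \<Upsilon> ending with it.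
      As \<open>c\<close> belongs to \<open>p\<close>, the opponent's count in the latter is that of
      \<open>us\<close>.\<close>
    have "num_moves p ys < num_moves p (us @ [c])" using us ys by simp
    then have "num_moves (opponent p) ys \<le> num_moves (opponent p) (us @ [c])"
      using r us' ys' by (meson not_le)
    moreover have "prefix (zs @ [b]) ys"
      using initial_segment_length_le_prefix[OF zs(1) ys'] less by simp
    from num_moves_prefix[OF this, of "opponent p"] have "k < num_moves (opponent p) ys"
      using zs by simp
    ultimately have "k < num_moves (opponent p) us" using us by simp
    then obtain vs d where vs: "prefix (vs @ [d]) us" "by_player (opponent p) d"
      "num_moves (opponent p) vs = k"
      using split_at_occurrence by blast
    have "initial_segment (vs @ [d]) \<Upsilon>"
      using vs us' initial_segment_prefix initial_segment_appendD by blast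
    moreover have "length vs < length us" using prefix_length_le[OF vs(1)] by simp
    ultimately show ?thesis
      unfolding later_def occurrence_at_def using us us' vs by blast
  qed
  then show "delay p \<Upsilon> \<Gamma>" using r by (simp add: delay_def)
qed

text \<open>In \<open>delay_iff\<close> this exchanges \<open>u\<close> with \<open>g\<close> and
  reorders the two inequalities. Results about delays can thus be used in both directions.\<close>

lemma delay_swap: "delay p \<Upsilon> \<Gamma> \<Longrightarrow> delay (opponent p) \<Gamma> \<Upsilon>"
  unfolding delay_iff opponent_opponent by (intro conjI allI impI notI) (simp, blast)

section \<open>Restricting finite runs to a branch\<close>

definition list_branch :: "(nat \<Rightarrow> bool) \<Rightarrow> labmove list \<Rightarrow> labmove list" where
  "list_branch x xs = map (map_prod id strip) (filter (on_branch x \<circ> snd) xs)"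

lemma list_branch_append: "list_branch x (xs @ ys) = list_branch x xs @ list_branch x ys"
  by (simp add: list_branch_def)

lemma branch_Fin: "branch (Fin xs) x = Fin (list_branch x xs)"
  by (simp add: branch_def list_branch_def)

lemma initial_segment_branch:
  "initial_segment xs (branch \<Gamma> x) \<longleftrightarrow> (\<exists>ys. initial_segment ys \<Gamma> \<and> xs = list_branch x ys)"
  unfolding branch_def list_branch_def initial_segment_map_seq initial_segment_filter_seq by blast

lemma filter_list_branch:
  "filter (by_player q) (list_branch x xs) = list_branch x (filter (by_player q) xs)"
  by (induction xs) (auto simp: list_branch_def)

text \<open>The \<open>q\<close>-moves of both segments are initial segments of one sequence, hence
  comparable, and \<open>list_branch\<close> is monotone for prefixes; so a strict inequality on the
  branch comes from one in the runs.\<close>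

lemma num_moves_list_branch_less:
  assumes "filter_seq (by_player q) s = filter_seq (by_player q) t"
    and "initial_segment xs s" "initial_segment ys t"
    and "num_moves q (list_branch x xs) < num_moves q (list_branch x ys)"
  shows "num_moves q xs < num_moves q ys"
proof -
  let ?f = "filter (by_player q)"
  have "initial_segment (?f xs) (filter_seq (by_player q) s)"
    "initial_segment (?f ys) (filter_seq (by_player q) s)"
    using assms initial_segment_filter_seq by metis+
  moreover have "\<not> prefix (?f ys) (?f xs)"
    using assms(4) unfolding filter_list_branch
    by (auto simp: prefix_def list_branch_append)
  ultimately show ?thesis
    using initial_segment_length_le_prefix by (metis not_le)
qed

text \<open>By \<open>num_moves_list_branch_less\<close>, a pair of branch segments violating the
  inequality of \<open>delay_iff\<close> lifts to such a pair in the runs themselves.\<close>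

lemma delay_branch:
  assumes "delay p \<Upsilon> \<Gamma>"
  shows "delay p (branch \<Upsilon> x) (branch \<Gamma> x)"
  unfolding delay_iff
proof (intro conjI allI impI)
  have same: "filter_seq (by_player q) \<Upsilon> = filter_seq (by_player q) \<Gamma>" for q
    using assms by (simp add: delay_def)
  fix q
  show "filter_seq (by_player q) (branch \<Upsilon> x) = filter_seq (by_player q) (branch \<Gamma> x)"
  proof (rule seq_eqI)
    have "initial_segment xs (filter_seq (by_player q) (branch \<Delta> x)) \<longleftrightarrow>
        (\<exists>zs. initial_segment zs (filter_seq (by_player q) \<Delta>) \<and> xs = list_branch x zs)" for xs \<Delta>
      unfolding initial_segment_filter_seq initial_segment_branch using filter_list_branch by metis
    then show "initial_segment xs (filter_seq (by_player q) (branch \<Upsilon> x)) \<longleftrightarrow>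
        initial_segment xs (filter_seq (by_player q) (branch \<Gamma> x))" for xs
      by (simp add: same)
  qed
  fix u g
  assume "initial_segment u (branch \<Upsilon> x)" "initial_segment g (branch \<Gamma> x)"
  then obtain us gs where us: "initial_segment us \<Upsilon>" "u = list_branch x us"
    and gs: "initial_segment gs \<Gamma>" "g = list_branch x gs"
    by (auto simp: initial_segment_branch)
  show "\<not> (num_moves p g < num_moves p u \<and> num_moves (opponent p) u < num_moves (opponent p) g)"
    using assms us gs num_moves_list_branch_less[OF same us(1) gs(1)]
      num_moves_list_branch_less[OF same[symmetric] gs(1) us(1)]
    unfolding delay_iff by blast
qed

section \<open>Recurrences\<close>

lemma is_game_legal_run_set: "is_game A \<Longrightarrow> legal_run_set (Lr A)"
  unfolding is_game_def legal_run_set_def by blast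

lemma Fin_mem_rec_Lr_iff:
  "Fin xs \<in> rec_Lr A \<longleftrightarrow>
     (\<forall>m\<in>set xs. \<exists>w \<alpha>. snd m = prefixed w \<alpha>) \<and> (\<forall>x. Fin (list_branch x xs) \<in> Lr A)"
  by (simp add: rec_Lr_def branch_Fin)

text \<open>Both conditions in \<open>rec_Lr\<close> can be tested on finite initial segments: each
  move occurs in one, and the initial segments of a branch are the branches of initial
  segments.\<close>

lemma legal_run_set_rec_Lr:
  assumes "legal_run_set (Lr A)"
  shows "legal_run_set (rec_Lr A)"
proof -
  have Nil: "Fin [] \<in> rec_Lr A"
    using legal_run_set_Nil[OF assms] by (simp add: Fin_mem_rec_Lr_iff list_branch_def)
  have "\<Gamma> \<in> rec_Lr A \<longleftrightarrow> (\<forall>xs. initial_segment xs \<Gamma> \<longrightarrow> Fin xs \<in> rec_Lr A)" for \<Gamma>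
  proof -
    have "branch \<Gamma> x \<in> Lr A \<longleftrightarrow> (\<forall>xs. initial_segment xs \<Gamma> \<longrightarrow> Fin (list_branch x xs) \<in> Lr A)" for x
      unfolding legal_run_set_iff[OF assms, of "branch \<Gamma> x"] initial_segment_branch by blast
    then have "\<Gamma> \<in> rec_Lr A \<longleftrightarrow>
        (\<forall>m xs. initial_segment xs \<Gamma> \<longrightarrow> m \<in> set xs \<longrightarrow> (\<exists>w \<alpha>. snd m = prefixed w \<alpha>)) \<and>
        (\<forall>x xs. initial_segment xs \<Gamma> \<longrightarrow> Fin (list_branch x xs) \<in> Lr A)"
      unfolding rec_Lr_def mem_Collect_eq Ball_def set_seq_iff_initial_segment by simp blast
    then show ?thesis unfolding Fin_mem_rec_Lr_iff by blast
  qed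
  then show ?thesis unfolding legal_run_set_def using Nil by metis
qed

text \<open>Completing \<open>us @ [(opponent p, \<gamma>)]\<close> by the moves of \<open>p\<close> that it lacks gives a run of which
  \<open>zs @ [(opponent p, \<beta>)]\<close> is an \<open>opponent p\<close>-delay. On a branch where the latter is illegal,
  staticity yields an illegal move of \<open>opponent p\<close>, which must precede the completion.\<close>

lemma illegal_rec_move_transfer:
  assumes A: "static_game A" and d: "delay p \<Upsilon> \<Gamma>"
    and Z: "initial_segment (zs @ [(opponent p, \<beta>)]) \<Gamma>"
    and Z_illegal: "Fin (zs @ [(opponent p, \<beta>)]) \<notin> rec_Lr A" and zs_legal: "Fin zs \<in> rec_Lr A"
    and U: "initial_segment (us @ [(opponent p, \<gamma>)]) \<Upsilon>"
    and num: "num_moves (opponent p) us = num_moves (opponent p) zs"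
  shows "Fin (us @ [(opponent p, \<gamma>)]) \<notin> rec_Lr A"
proof
  define Z where "Z = zs @ [(opponent p, \<beta>)]"
  define U where "U = us @ [(opponent p, \<gamma>)]"
  note Z = Z[folded Z_def] and U = U[folded U_def] and Z_illegal = Z_illegal[folded Z_def]
  assume "Fin (us @ [(opponent p, \<gamma>)]) \<in> rec_Lr A"
  then have U_legal: "Fin U \<in> rec_Lr A" by (simp add: U_def)
  have L: "legal_run_set (Lr A)"
    using A by (simp add: static_game_def is_game_legal_run_set)
  have same: "filter_seq (by_player q) \<Upsilon> = filter_seq (by_player q) \<Gamma>" for q
    using d by (simp add: delay_def)
  have prefixI: "prefix (filter (by_player q) u) (filter (by_player q) g)"
    if "initial_segment u \<Upsilon>" "initial_segment g \<Gamma>" "num_moves q u \<le> num_moves q g" for u g q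
    using that same by (metis initial_segment_filter_seq initial_segment_length_le_prefix)
  have us: "initial_segment us \<Upsilon>" using U initial_segment_appendD by (auto simp: U_def)
  have opp: "filter (by_player (opponent p)) U = filter (by_player (opponent p)) Z"
  proof -
    have "num_moves (opponent p) U = num_moves (opponent p) Z" using num by (simp add: U_def Z_def)
    then show ?thesis using prefixI[OF U Z, of "opponent p"] by (auto simp: prefix_def)
  qed
  \<comment> \<open>Being behind in moves of the opponent, \<open>us\<close> cannot be ahead of
    \<open>Z\<close> in moves of \<open>p\<close>. So \<open>U\<close> lacks only a final stretch
    \<open>R\<close> of the moves of \<open>p\<close> in \<open>Z\<close>.\<close>
  have "num_moves (opponent p) us < num_moves (opponent p) Z" using num by (simp add: Z_def)
  then have "num_moves p us \<le> num_moves p Z"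
    using d us Z unfolding delay_iff by (meson not_le)
  then have "prefix (filter (by_player p) U) (filter (by_player p) Z)"
    using prefixI[OF us Z] by (simp add: U_def)
  then obtain R where R: "filter (by_player p) Z = filter (by_player p) U @ R"
    by (auto simp: prefix_def)
  have "set R \<subseteq> set (filter (by_player p) Z)" by (simp add: R)
  then have R_p: "\<forall>m\<in>set R. fst m = p" by auto
  \<comment> \<open>The move \<beta> has the right shape because it also occurs in \<open>U\<close>,
    assumed legal; the illegality of \<open>Z\<close> must therefore show on some branch.\<close>
  have "\<forall>m\<in>set Z. \<exists>w \<alpha>. snd m = prefixed w \<alpha>"
  proof -
    have "(opponent p, \<beta>) \<in> set (filter (by_player (opponent p)) U)"
      unfolding opp by (simp add: Z_def)
    then have "\<exists>w \<alpha>. snd (opponent p, \<beta>) = prefixed w \<alpha>"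
      using U_legal unfolding Fin_mem_rec_Lr_iff by (meson filter_is_subset subsetD)
    then show ?thesis
      using zs_legal unfolding Fin_mem_rec_Lr_iff by (auto simp: Z_def)
  qed
  then obtain x where x: "Fin (list_branch x Z) \<notin> Lr A"
    using Z_illegal by (auto simp: Fin_mem_rec_Lr_iff)
  have x_zs: "Fin (list_branch x zs) \<in> Lr A" using zs_legal by (simp add: Fin_mem_rec_Lr_iff)
  \<comment> \<open>If \<beta> were off the branch \<open>x\<close>, it would leave the legal
    \<open>list_branch x zs\<close> unchanged.\<close>
  have "list_branch x Z = list_branch x zs @ [(opponent p, strip \<beta>)]"
    using x x_zs by (cases "on_branch x \<beta>") (simp_all add: Z_def list_branch_def)
  then have "illegal_for (opponent p) (Lr A) (branch (Fin Z) x)"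
    unfolding illegal_for_iff[OF L] branch_Fin using x x_zs by auto
  moreover have "delay p (Fin (U @ R)) (Fin Z)"
    unfolding delay_iff
  proof (intro conjI allI impI notI)
    fix q
    have "filter (by_player q) (U @ R) = filter (by_player q) Z"
    proof (cases "q = p")
      case True
      then show ?thesis using R R_p by simp
    next
      case False
      then have "filter (by_player q) R = []" using R_p by (auto simp: filter_empty_conv)
      moreover have "q = opponent p" using False by (simp add: player_neq_iff)
      ultimately show ?thesis using opp by simp
    qed
    then show "filter_seq (by_player q) (Fin (U @ R)) = filter_seq (by_player q) (Fin Z)" by simp
  next
    fix u g
    assume u: "initial_segment u (Fin (U @ R))" and g: "initial_segment g (Fin Z)"
      and lag: "num_moves p g < num_moves p u \<and>
        num_moves (opponent p) u < num_moves (opponent p) g"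
    have "num_moves (opponent p) g \<le> num_moves (opponent p) Z"
      using g by (simp add: num_moves_prefix)
    \<comment> \<open>With fewer opponent's moves than \<open>U\<close>, the segment
      \<open>u\<close> ends within \<open>U\<close>, so the condition is inherited from \<Upsilon>
      and \<Gamma>.\<close>
    then have "num_moves (opponent p) u < num_moves (opponent p) U" using lag opp by simp
    then have "\<not> prefix U u" using num_moves_prefix[of U u "opponent p"] by linarith
    then have "prefix u U" using u prefix_same_cases[of u "U @ R" U] by auto
    then have "initial_segment u \<Upsilon>" using U initial_segment_prefix by blast
    moreover have "initial_segment g \<Gamma>" using g Z initial_segment_prefix by auto
    ultimately show False using d lag unfolding delay_iff by blast
  qed
  ultimately have "illegal_for (opponent p) (Lr A) (branch (Fin (U @ R)) x)"
    using A delay_branch[OF delay_swap] unfolding static_game_def static_def legal_for_def by blast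
  then obtain ws \<delta> where ws: "prefix (ws @ [(opponent p, \<delta>)]) (list_branch x U @ list_branch x R)"
    and ws_illegal: "Fin (ws @ [(opponent p, \<delta>)]) \<notin> Lr A"
    by (auto simp: illegal_for_iff[OF L] branch_Fin list_branch_append)
  have "prefix (ws @ [(opponent p, \<delta>)]) (list_branch x U)"
  proof (rule ccontr)
    assume "\<not> ?thesis"
    then obtain vs where vs: "ws @ [(opponent p, \<delta>)] = list_branch x U @ vs" "vs \<noteq> []"
      "prefix vs (list_branch x R)"
      using ws by (auto simp: prefix_append)
    then have "(opponent p, \<delta>) \<in> set (list_branch x R)"
      using set_mono_prefix[OF vs(3)] by (metis last_appendR last_in_set last_snoc subsetD)
    then show False using R_p by (auto simp: list_branch_def)
  qed
  then show False
    using ws_illegal U_legal legal_run_set_prefix[OF L] by (auto simp: Fin_mem_rec_Lr_iff)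
qed

lemma corresponding_move:
  assumes "filter_seq (by_player q) \<Upsilon> = filter_seq (by_player q) \<Gamma>"
    and "initial_segment (xs @ [(q, \<alpha>)]) \<Upsilon>"
  obtains ys \<beta> where "initial_segment (ys @ [(q, \<beta>)]) \<Gamma>" "num_moves q ys = num_moves q xs"
proof -
  obtain g where g: "initial_segment g \<Gamma>"
    "filter (by_player q) g = filter (by_player q) (xs @ [(q, \<alpha>)])"
    using filter_seq_eq_initial_segment[OF assms] .
  then obtain ys a where "prefix (ys @ [a]) g" "fst a = q" "num_moves q ys = num_moves q xs"
    using split_at_occurrence[of "num_moves q xs" "by_player q" g] by auto
  then show ?thesis
    using that[of ys "snd a"] initial_segment_prefix[OF g(1)] by (metis prod.collapse)
qed

lemma illegal_for_rec_Lr_delay: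
  assumes A: "static_game A" and d: "delay p \<Upsilon> \<Gamma>"
    and ill: "illegal_for p (rec_Lr A) \<Upsilon>"
  shows "illegal_for p (rec_Lr A) \<Gamma>"
proof (rule ccontr)
  assume not_p: "\<not> ?thesis"
  have L: "legal_run_set (rec_Lr A)"
    using A by (simp add: static_game_def is_game_legal_run_set legal_run_set_rec_Lr)
  have same: "filter_seq (by_player q) \<Upsilon> = filter_seq (by_player q) \<Gamma>" for q
    using d by (simp add: delay_def)
  obtain xs \<alpha> where Y: "initial_segment (xs @ [(p, \<alpha>)]) \<Upsilon>"
    "Fin (xs @ [(p, \<alpha>)]) \<notin> rec_Lr A" "Fin xs \<in> rec_Lr A"
    using ill by (auto simp: illegal_for_iff[OF L])
  obtain vs \<alpha>' where V: "initial_segment (vs @ [(p, \<alpha>')]) \<Gamma>" "num_moves p vs = num_moves p xs"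
    using corresponding_move[OF same Y(1)] .
  \<comment> \<open>The transfer lemma with runs and players exchanged: \<Gamma> is now the
    \<open>opponent p\<close>-delay of \<Upsilon>.\<close>
  have V_illegal: "Fin (vs @ [(p, \<alpha>')]) \<notin> rec_Lr A"
    using illegal_rec_move_transfer[OF A delay_swap[OF d], of xs \<alpha> vs \<alpha>'] Y V by simp
  then have "\<Gamma> \<notin> rec_Lr A" using V legal_run_set_iff[OF L] by blast
  then have "illegal_for (opponent p) (rec_Lr A) \<Gamma>"
    using illegal_for_exists[OF L] not_p by (metis player_neq_iff)
  then obtain zs \<beta> where Z: "initial_segment (zs @ [(opponent p, \<beta>)]) \<Gamma>"
    "Fin (zs @ [(opponent p, \<beta>)]) \<notin> rec_Lr A" "Fin zs \<in> rec_Lr A"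
    by (auto simp: illegal_for_iff[OF L])
  have "\<not> prefix (vs @ [(p, \<alpha>')]) zs" using V_illegal Z legal_run_set_prefix[OF L] by blast
  then have Z_vs: "prefix (zs @ [(opponent p, \<beta>)]) vs"
    using initial_segment_comparable[OF V(1) Z(1)] by auto
  obtain us \<gamma> where U: "initial_segment (us @ [(opponent p, \<gamma>)]) \<Upsilon>"
    "num_moves (opponent p) us = num_moves (opponent p) zs"
    using corresponding_move[OF same[symmetric] Z(1)] .
  have U_illegal: "Fin (us @ [(opponent p, \<gamma>)]) \<notin> rec_Lr A"
    using illegal_rec_move_transfer[OF A d Z U] .
  \<comment> \<open>Since \<open>xs @ [(p, \<alpha>)]\<close> has one move of \<open>p\<close> more
    than \<open>vs\<close>, the delay condition gives it at least as many moves of the opponent, the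
    illegal one among them.\<close>
  have "num_moves (opponent p) us < num_moves (opponent p) vs"
    using num_moves_prefix[OF Z_vs, of "opponent p"] U by simp
  moreover have "num_moves p vs < num_moves p (xs @ [(p, \<alpha>)])" using V by simp
  moreover have "initial_segment vs \<Gamma>" using V initial_segment_appendD by blast
  ultimately have "num_moves (opponent p) vs \<le> num_moves (opponent p) (xs @ [(p, \<alpha>)])"
    using d Y(1) unfolding delay_iff by (meson not_le)
  then have "num_moves (opponent p) us < num_moves (opponent p) (xs @ [(p, \<alpha>)])"
    using \<open>num_moves (opponent p) us < num_moves (opponent p) vs\<close> by simp
  then have "prefix (us @ [(opponent p, \<gamma>)]) (xs @ [(p, \<alpha>)])"
    using prefix_occurrence(1)[OF U(1) _ Y(1), of "by_player (opponent p)"] by simp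
  \<comment> \<open>The two segments end with moves of different players, so the prefix is
    proper.\<close>
  then have "prefix (us @ [(opponent p, \<gamma>)]) xs" by auto
  then show False using U_illegal Y legal_run_set_prefix[OF L] by blast
qed

section \<open>Static games from legal runs and a winning condition\<close>

lemma make_game_simps [simp]:
  "Lr (make_game L W) = L"
  "Wn (make_game L W) \<Gamma> = (if \<Gamma> \<in> L then (if W \<Gamma> then Machine else Environment)
                else if illegal_for Machine L \<Gamma> then Environment else Machine)"
  by (simp_all add: make_game_def)

text \<open>This isolates what \<open>Rec\<close> and \<open>Corec\<close> share. Assuming
  preservation of \<open>W\<close> for \<open>Machine\<close> suffices, as \<open>delay_swap\<close>
  turns the claim for \<open>Environment\<close> into its contrapositive.\<close>

lemma static_game_make_game:
  assumes L: "legal_run_set L"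
    and illegal: "\<And>p \<Upsilon> \<Gamma>. delay p \<Upsilon> \<Gamma> \<Longrightarrow> illegal_for p L \<Upsilon> \<Longrightarrow> illegal_for p L \<Gamma>"
    and W: "\<And>\<Upsilon> \<Gamma>. delay Machine \<Upsilon> \<Gamma> \<Longrightarrow> W \<Gamma> \<Longrightarrow> W \<Upsilon>"
  shows "static_game (make_game L W)"
proof -
  let ?G = "make_game L W"
  \<comment> \<open>\<open>make_game\<close> asks only whether \<open>Machine\<close> offends;
    uniqueness of the offender settles the case of \<open>Environment\<close>.\<close>
  have Wn_illegal: "Wn ?G \<Gamma> = opponent p" if "illegal_for p L \<Gamma>" for \<Gamma> p
    using illegal_for_notin[OF L that] illegal_for_unique[OF L that, of Machine] that
    by (cases p) auto
  have "Wn ?G \<Upsilon> = p" if d: "delay p \<Upsilon> \<Gamma>" and won: "Wn ?G \<Gamma> = p" for p \<Upsilon> \<Gamma>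
  proof (cases "\<Gamma> \<in> L")
    case False
    then obtain q where q: "illegal_for q L \<Gamma>" using illegal_for_exists[OF L] by blast
    \<comment> \<open>The winner of an illegal run is the opponent of the offender, and
      \<open>opponent p\<close> offends in \<Upsilon> as well, because \<Gamma> is an
      \<open>opponent p\<close>-delay of \<Upsilon>.\<close>
    then have "q = opponent p" using Wn_illegal[OF q] won by (metis opponent_opponent)
    then have "illegal_for (opponent p) L \<Upsilon>" using illegal[OF delay_swap[OF d]] q by simp
    then show ?thesis using Wn_illegal by fastforce
  next
    case \<Gamma>: True
    show ?thesis
    proof (cases "\<Upsilon> \<in> L")
      case False
      then obtain q where q: "illegal_for q L \<Upsilon>" using illegal_for_exists[OF L] by blast
      then have "q \<noteq> p" using illegal[OF d] illegal_for_notin[OF L] \<Gamma> by blast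
      then show ?thesis using Wn_illegal[OF q] by (simp add: player_neq_iff)
    next
      case True
      then show ?thesis
        using \<Gamma> won W[of \<Upsilon> \<Gamma>] W[of \<Gamma> \<Upsilon>] d delay_swap[OF d]
        by (cases p) (auto split: if_splits)
    qed
  qed
  then have "static ?G"
    unfolding static_def legal_for_def make_game_simps(1) using illegal by blast
  moreover have "is_game ?G"
    unfolding is_game_def make_game_simps(1) using L[unfolded legal_run_set_def] Wn_illegal by blast
  ultimately show ?thesis by (simp add: static_game_def)
qed

theorem theorem3p3:
  fixes A :: game
  assumes "static_game A"
  shows "static_game (Rec A) \<and> static_game (Corec A)"
proof -
  have L: "legal_run_set (rec_Lr A)"
    using assms by (simp add: static_game_def is_game_legal_run_set legal_run_set_rec_Lr)
  \<comment> \<open>Staticity is used with \<open>v\<close> fixed, so it serves the universal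
    quantifier in \<open>Rec\<close> and the existential one in \<open>Corec\<close> alike.\<close>
  have "Wn A (branch \<Upsilon> v) = Machine"
    if "delay Machine \<Upsilon> \<Gamma>" "Wn A (branch \<Gamma> v) = Machine" for \<Upsilon> \<Gamma> v
    using assms delay_branch[OF that(1)] that(2) unfolding static_game_def static_def by blast
  then show ?thesis
    unfolding Rec_def Corec_def
    by (intro conjI static_game_make_game[OF L illegal_for_rec_Lr_delay[OF assms]]) blast+
qed

end
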